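(* Let $n$, $a_1$, $a_2$ be positive integers and let $S=S(a_1,a_2)=\{x_1a_1+x_2a_2 : x_1,x_2\in\{0,1,2,\ldots\}\}$. Then the following three sets have the same cardinality: (i) the set of partitions of $n$ in which each part lies in $S$ and each difference $\lambda-\mu\ge 0$ between two parts $\lambda,\mu$ lies in $S$; (ii) the set of partitions of $n$ in which each part appears with multiplicity lying in $S$; (iii) the set of partitions of $n$ in which each part is divisible by $a_1$ or by $a_2$.
   Context: A partition of $n$ is an unordered multiset of positive integers (parts) whose sum is $n$. The multiplicity of a part is the number of times it occurs in the multiset. *)

theory Defs
  imports Main "HOL-Library.Multiset"
begin

definition partitions_of :: "nat \<Rightarrow> nat multiset set" where
  "partitions_of n = {P. (\<forall>p \<in># P. 0 < p) \<and> sum_mset P = n}"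

definition semigroup_gen2 :: "nat \<Rightarrow> nat \<Rightarrow> nat set" where
  "semigroup_gen2 a b = {x * a + y * b | x y. True}"

text \<open>Finiteness makes equality of \<open>card\<close> on subsets of \<open>partitions_of n\<close> a genuine
  equality of cardinalities.\<close>

lemma finite_partitions_of: "finite (partitions_of n)"
proof (rule finite_subset)
  show "finite (mset ` {xs. set xs \<subseteq> {..n} \<and> length xs \<le> n})"
    by (intro finite_imageI finite_lists_length_le) simp
  show "partitions_of n \<subseteq> mset ` {xs. set xs \<subseteq> {..n} \<and> length xs \<le> n}"
  proof
    fix P assume P: "P \<in> partitions_of n"
    obtain xs where xs: "P = mset xs" by (metis ex_mset)
    have pos: "\<forall>x \<in> set xs. 0 < x" and sum: "sum_list xs = n"
      using P by (auto simp: partitions_of_def xs sum_mset_sum_list)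
    have "length xs \<le> sum_list xs" using pos by (induction xs) auto
    moreover have "set xs \<subseteq> {..n}" using sum by (auto intro: member_le_sum_list)
    ultimately show "P \<in> mset ` {xs. set xs \<subseteq> {..n} \<and> length xs \<le> n}"
      using xs sum by auto
  qed
qed

end

theory Submission
  imports Defs
begin

text \<open>Differences of parts and multiplicities are exchanged by conjugation, which gives (i) = (ii).
  For (ii) = (iii), let \<open>L = lcm a1 a2 = a2 * c\<close>. Every element of \<open>S\<close> is uniquely
  \<open>x * a1 + y * a2\<close> with \<open>y < c\<close>, so pairs consisting of a partition of type (ii) and a
  partition into multiples of \<open>L\<close> correspond to pairs consisting of a partition into multiples
  of \<open>a1\<close> and a partition into multiples of \<open>a2\<close>. The same holds for type (iii), and the
  partitions into multiples of \<open>L\<close> can be cancelled.\<close>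

section \<open>Encoding partitions as lists of steps\<close>

text \<open>A step \<open>(d, m)\<close> is a part of multiplicity \<open>m\<close> that exceeds the next smaller part (or 0) by
  \<open>d\<close>; steps are listed from the smallest part upwards. Conjugation of the Young diagram then
  reverses the list and swaps the entries of each pair.\<close>

fun of_steps :: "(nat \<times> nat) list \<Rightarrow> nat multiset" where
  "of_steps [] = {#}"
| "of_steps ((d, m) # l) = replicate_mset m d + image_mset ((+) d) (of_steps l)"

text \<open>Positivity makes the encoding unique: \<open>[(d, m), (0, m')]\<close> and
  \<open>[(d, m + m')]\<close> give the same multiset, and so do \<open>[(d, 0), (d', m)]\<close>
  and \<open>[(d + d', m)]\<close>.\<close>

definition positive_steps :: "(nat \<times> nat) list set" where
  "positive_steps = {l. \<forall>(d, m) \<in> set l. 0 < d \<and> 0 < m}"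

definition conj_steps :: "(nat \<times> nat) list \<Rightarrow> (nat \<times> nat) list" where
  "conj_steps l = rev (map prod.swap l)"

lemma positive_steps_Cons [simp]:
  "(d, m) # l \<in> positive_steps \<longleftrightarrow> 0 < d \<and> 0 < m \<and> l \<in> positive_steps"
  by (auto simp: positive_steps_def)

lemma of_steps_pos: "l \<in> positive_steps \<Longrightarrow> p \<in># of_steps l \<Longrightarrow> 0 < p"
  by (induction l arbitrary: p rule: of_steps.induct) (auto split: if_splits)

lemma count_image_plus: "count (image_mset ((+) d) M) p = (if d \<le> p then count M (p - d) else 0)"
  for d p :: nat
  by (induction M) auto

text \<open>The parts of the tail are positive, so after the shift by \<open>d\<close> they exceed
  \<open>d\<close> and cannot collide with the \<open>m\<close> copies of it.\<close>

lemma count_of_steps_Cons: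
  assumes "(d, m) # l \<in> positive_steps"
  shows "count (of_steps ((d, m) # l)) p =
    (if p < d then 0 else if p = d then m else count (of_steps l) (p - d))"
proof -
  have "count (of_steps l) 0 = 0"
    using of_steps_pos[of l 0] assms not_in_iff by fastforce
  then show ?thesis by (auto simp: count_image_plus)
qed

text \<open>The least part and its multiplicity recover the first step; removing its copies and
  undoing the shift recovers the tail.\<close>

lemma inj_on_of_steps: "inj_on of_steps positive_steps"
proof (rule inj_onI)
  fix l l' assume "l \<in> positive_steps" "l' \<in> positive_steps" "of_steps l = of_steps l'"
  then show "l = l'"
  proof (induction l arbitrary: l' rule: of_steps.induct)
    case 1
    then show ?case by (cases l' rule: of_steps.cases) auto
  next
    case (2 d m l)
    then obtain d' m' k where l': "l' = (d', m') # k"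
      by (cases l' rule: of_steps.cases) auto
    have c: "(if p < d then 0 else if p = d then m else count (of_steps l) (p - d)) =
        (if p < d' then 0 else if p = d' then m' else count (of_steps k) (p - d'))" for p
      using 2 count_of_steps_Cons[of d m l p] count_of_steps_Cons[of d' m' k p]
      by (simp add: l')
    \<comment> \<open>If \<open>d < d'\<close>, the counts at \<open>d\<close> would be
      \<open>m > 0\<close> on one side and 0 on the other; the case \<open>d' < d\<close> is
      symmetric.\<close>
    have d: "d = d'"
      using c[of d] c[of d'] 2(2,3) by (auto simp: l' split: if_splits)
    then have m: "m = m'" using c[of d] by simp
    have "image_mset ((+) d) (of_steps l) = image_mset ((+) d) (of_steps k)"
      using 2(4) by (simp add: l' d m)
    then have "of_steps l = of_steps k"
      by (rule injD[OF multiset.inj_map, rotated]) simp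
    then show ?case using 2 by (auto simp: l' d m)
  qed
qed

text \<open>Removing all copies of the least part \<open>d\<close> and lowering the other parts by
  \<open>d\<close> leaves fewer parts, all positive, so induction on the size applies.\<close>

lemma ex_of_steps:
  assumes "\<forall>p \<in># P. 0 < p"
  shows "\<exists>l \<in> positive_steps. of_steps l = P"
  using assms
proof (induction "size P" arbitrary: P rule: less_induct)
  case less
  show ?case
  proof (cases "P = {#}")
    case True
    then show ?thesis by (intro bexI[of _ "[]"]) (auto simp: positive_steps_def)
  next
    case False
    define d where "d = Min (set_mset P)"
    have d: "d \<in># P" "\<And>p. p \<in># P \<Longrightarrow> d \<le> p"
      using False by (auto simp: d_def)
    define Q where "Q = image_mset (\<lambda>p. p - d) (filter_mset (\<lambda>p. p \<noteq> d) P)"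
    have "size Q < size P"
      using size_filter_unsat_elem[OF d(1), of "\<lambda>p. p \<noteq> d"] by (simp add: Q_def)
    moreover have "\<forall>p \<in># Q. 0 < p"
      using d(2) by (force simp: Q_def)
    ultimately obtain l where l: "l \<in> positive_steps" "of_steps l = Q"
      using less by blast
    \<comment> \<open>Truncated subtraction loses nothing here, since \<open>d\<close> is the least
      part.\<close>
    have "image_mset ((+) d) Q = filter_mset (\<lambda>p. p \<noteq> d) P"
      using d(2) by (auto simp: Q_def multiset.map_comp intro!: image_mset_cong[where g = id, simplified])
    moreover have "replicate_mset (count P d) d = filter_mset (\<lambda>p. p = d) P"
      by (metis filter_eq_replicate_mset)
    ultimately have "of_steps ((d, count P d) # l) = P"
      using l by simp
    moreover have "(d, count P d) # l \<in> positive_steps"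
      using l d(1) less.prems by auto
    ultimately show ?thesis by blast
  qed
qed

lemma bij_betw_of_steps: "bij_betw of_steps positive_steps {P. \<forall>p \<in># P. 0 < p}"
  using inj_on_of_steps of_steps_pos ex_of_steps
  by (fastforce simp: bij_betw_def)

section \<open>Conjugation: differences of parts against multiplicities\<close>

lemma size_of_steps: "size (of_steps l) = sum_list (map snd l)"
  by (induction l rule: of_steps.induct) auto

lemma sum_mset_plus_const: "(\<Sum>p\<in>#M. d + p) = d * size M + \<Sum>\<^sub># M" for d :: nat
  by (induction M) auto

lemma sum_of_steps_Cons:
  "\<Sum>\<^sub># (of_steps ((d, m) # l)) = d * (m + sum_list (map snd l)) + \<Sum>\<^sub># (of_steps l)"
  by (simp add: sum_mset_plus_const size_of_steps algebra_simps)

text \<open>A last step contributes \<open>m\<close> copies of the largest part, which is the sum of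
  all differences. This is the formula of \<open>sum_of_steps_Cons\<close> with the two entries of
  every step swapped.\<close>

lemma sum_of_steps_snoc:
  "\<Sum>\<^sub># (of_steps (l @ [(d, m)])) = m * (d + sum_list (map fst l)) + \<Sum>\<^sub># (of_steps l)"
proof (induction l)
  case (Cons x l)
  then show ?case
    by (cases x) (simp add: sum_of_steps_Cons algebra_simps del: of_steps.simps)
qed simp

text \<open>Reversal turns a first step into a last one and swapping exchanges \<open>fst\<close>
  and \<open>snd\<close>, so both sides gain the same amount.\<close>

lemma sum_of_steps_conj: "\<Sum>\<^sub># (of_steps (conj_steps l)) = \<Sum>\<^sub># (of_steps l)"
proof (induction l)
  case (Cons x l)
  then show ?case
    by (cases x) (simp add: sum_of_steps_Cons sum_of_steps_snoc conj_steps_def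
        comp_def rev_map[symmetric] del: of_steps.simps)
qed (simp add: conj_steps_def)

text \<open>Every part, and every difference of two parts, is a sum of consecutive first entries;
  conversely each first entry is the least part or the difference of two neighbouring parts. The
  guard \<open>q \<le> p\<close> keeps truncated subtraction genuine.\<close>

lemma of_steps_diffs_iff:
  assumes "0 \<in> S" and "\<And>x y. x \<in> S \<Longrightarrow> y \<in> S \<Longrightarrow> x + y \<in> S" and "l \<in> positive_steps"
  shows "(\<forall>p \<in># of_steps l. p \<in> S) \<and> (\<forall>p \<in># of_steps l. \<forall>q \<in># of_steps l. q \<le> p \<longrightarrow> p - q \<in> S)
    \<longleftrightarrow> (\<forall>d \<in> fst ` set l. d \<in> S)"
  using assms(3)
proof (induction l rule: of_steps.induct)
  case (2 d m l)
  have set: "set_mset (of_steps ((d, m) # l)) = insert d ((+) d ` set_mset (of_steps l))"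
    using 2 by auto
  \<comment> \<open>A part \<open>p\<close> of the tail is the difference between
    \<open>d + p\<close> and the least part \<open>d\<close>, so differences on the left give
    membership of tail parts on the right. The difference of \<open>d\<close> with itself needs
    \<open>0 \<in> S\<close>.\<close>
  have "(\<forall>p \<in># of_steps ((d, m) # l). p \<in> S) \<and>
      (\<forall>p \<in># of_steps ((d, m) # l). \<forall>q \<in># of_steps ((d, m) # l). q \<le> p \<longrightarrow> p - q \<in> S)
    \<longleftrightarrow> d \<in> S \<and> (\<forall>p \<in># of_steps l. p \<in> S) \<and>
      (\<forall>p \<in># of_steps l. \<forall>q \<in># of_steps l. q \<le> p \<longrightarrow> p - q \<in> S)"
    unfolding set using assms(1,2) by auto
  then show ?case using 2 by auto
qed simp

lemma of_steps_counts_iff: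
  assumes "l \<in> positive_steps"
  shows "(\<forall>p \<in># of_steps l. count (of_steps l) p \<in> S) \<longleftrightarrow> (\<forall>m \<in> snd ` set l. m \<in> S)"
  using assms
proof (induction l rule: of_steps.induct)
  case (2 d m l)
  have set: "set_mset (of_steps ((d, m) # l)) = insert d ((+) d ` set_mset (of_steps l))"
    using 2 by auto
  have "(\<forall>p \<in># of_steps ((d, m) # l). count (of_steps ((d, m) # l)) p \<in> S)
    \<longleftrightarrow> m \<in> S \<and> (\<forall>p \<in># of_steps l. count (of_steps l) p \<in> S)"
    unfolding set using 2(2) of_steps_pos[of l]
    by (auto simp: count_of_steps_Cons simp del: of_steps.simps)
  then show ?case using 2 by auto
qed simp

lemma card_diffs_eq_card_counts:
  assumes "0 \<in> S" and "\<And>x y. x \<in> S \<Longrightarrow> y \<in> S \<Longrightarrow> x + y \<in> S"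
  shows "card {P \<in> partitions_of n. (\<forall>p \<in># P. p \<in> S) \<and>
      (\<forall>p \<in># P. \<forall>q \<in># P. q \<le> p \<longrightarrow> p - q \<in> S)}
    = card {P \<in> partitions_of n. \<forall>p \<in># P. count P p \<in> S}" (is "card ?A = card ?B")
proof -
  let ?L = "\<lambda>f :: nat \<times> nat \<Rightarrow> nat. {l \<in> positive_steps. \<Sum>\<^sub># (of_steps l) = n \<and> (\<forall>d \<in> f ` set l. d \<in> S)}"
  have im: "{P \<in> partitions_of n. R P} = of_steps ` {l \<in> positive_steps. \<Sum>\<^sub># (of_steps l) = n \<and> R (of_steps l)}" for R
    using bij_betw_imp_surj_on[OF bij_betw_of_steps] by (auto simp: partitions_of_def)
  have card: "card {P \<in> partitions_of n. R P} = card {l \<in> positive_steps. \<Sum>\<^sub># (of_steps l) = n \<and> R (of_steps l)}" for R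
    unfolding im by (intro card_image inj_on_subset[OF inj_on_of_steps]) auto
  have "card ?A = card (?L fst)"
    unfolding card 
    by (intro arg_cong[where f = card] Collect_cong conj_cong refl) (rule of_steps_diffs_iff[OF assms])
  also have "\<dots> = card (?L snd)"
    \<comment> \<open>\<open>conj_steps\<close> is an involution, so it serves as its own
      inverse.\<close>
    by (rule bij_betw_same_card[of conj_steps], rule bij_betw_byWitness[where f' = conj_steps])
      (force simp: conj_steps_def positive_steps_def rev_map sum_of_steps_conj[unfolded conj_steps_def rev_map] comp_def)+
  also have "\<dots> = card ?B"
    unfolding card 
    by (intro arg_cong[where f = card] Collect_cong conj_cong refl) (simp add: of_steps_counts_iff)
  finally show ?thesis .
qed

section \<open>Cancelling the partitions into multiples of \<open>L\<close>\<close>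

text \<open>A multiset \<open>Q\<close> stands for the partition with parts \<open>L * q\<close>, \<open>q\<close> in \<open>Q\<close>.\<close>

definition scaled_partitions :: "nat \<Rightarrow> nat \<Rightarrow> nat multiset set" where
  "scaled_partitions L n = {Q. (\<forall>q \<in># Q. 0 < q) \<and> L * \<Sum>\<^sub># Q \<le> n}"

lemma finite_scaled_partitions:
  assumes "0 < L"
  shows "finite (scaled_partitions L n)"
proof (rule finite_subset)
  show "scaled_partitions L n \<subseteq> (\<Union>k\<le>n. partitions_of k)"
  proof
    fix Q assume "Q \<in> scaled_partitions L n"
    moreover have "\<Sum>\<^sub># Q \<le> L * \<Sum>\<^sub># Q"
      using mult_le_mono1[of 1 L "\<Sum>\<^sub># Q"] assms by simp
    ultimately have "(\<forall>q \<in># Q. 0 < q) \<and> \<Sum>\<^sub># Q \<le> n"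
      unfolding scaled_partitions_def by (metis (no_types, lifting) le_trans mem_Collect_eq)
    then show "Q \<in> (\<Union>k\<le>n. partitions_of k)"
      by (simp add: partitions_of_def)
  qed
qed (simp add: finite_partitions_of)

text \<open>The summand for \<open>Q = {#}\<close> is the cardinality wanted; all others belong to smaller \<open>n\<close>.\<close>

lemma card_partitions_cancel:
  fixes A B :: "nat multiset set"
  assumes "0 < L"
    and "\<And>n. card (SIGMA Q:scaled_partitions L n. A \<inter> partitions_of (n - L * \<Sum>\<^sub># Q))
      = card (SIGMA Q:scaled_partitions L n. B \<inter> partitions_of (n - L * \<Sum>\<^sub># Q))"
  shows "card (A \<inter> partitions_of n) = card (B \<inter> partitions_of n)"
proof (induction n rule: less_induct)
  case (less n)
  have split: "card (SIGMA Q:scaled_partitions L n. C \<inter> partitions_of (n - L * \<Sum>\<^sub># Q))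
    = card (C \<inter> partitions_of n)
      + (\<Sum>Q\<in>scaled_partitions L n - {{#}}. card (C \<inter> partitions_of (n - L * \<Sum>\<^sub># Q)))" for C
  proof -
    have "card (SIGMA Q:scaled_partitions L n. C \<inter> partitions_of (n - L * \<Sum>\<^sub># Q))
      = (\<Sum>Q\<in>scaled_partitions L n. card (C \<inter> partitions_of (n - L * \<Sum>\<^sub># Q)))"
      by (simp add: card_SigmaI finite_scaled_partitions assms(1) finite_partitions_of)
    also have "\<dots> = card (C \<inter> partitions_of n)
      + (\<Sum>Q\<in>scaled_partitions L n - {{#}}. card (C \<inter> partitions_of (n - L * \<Sum>\<^sub># Q)))"
      by (subst sum.remove[of _ "{#}"])
        (simp_all add: finite_scaled_partitions assms(1), simp add: scaled_partitions_def)
    finally show ?thesis .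
  qed
  have "card (A \<inter> partitions_of (n - L * \<Sum>\<^sub># Q)) = card (B \<inter> partitions_of (n - L * \<Sum>\<^sub># Q))"
    if "Q \<in> scaled_partitions L n - {{#}}" for Q
  proof (rule less)
    have "Q \<noteq> {#}" using that by simp
    then obtain q where "q \<in># Q" by (rule multiset_nonemptyE)
    then have "0 < \<Sum>\<^sub># Q" using that by (auto simp: scaled_partitions_def sum_mset.remove)
    then have "0 < L * \<Sum>\<^sub># Q" using assms(1) by simp
    \<comment> \<open>This bound forces \<open>n\<close> to be positive; for \<open>n = 0\<close>
      truncated subtraction could not go below \<open>n\<close>.\<close>
    moreover have "L * \<Sum>\<^sub># Q \<le> n" using that by (auto simp: scaled_partitions_def)
    ultimately show "n - L * \<Sum>\<^sub># Q < n" by linarith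
  qed
  then show ?case using assms(2)[of n] unfolding split by simp
qed

section \<open>Multiplicities in the semigroup\<close>

text \<open>The weight \<open>a * \<Sum>\<^sub># X\<close> arises in two ways: from repeating each
  part of \<open>X\<close> \<open>a\<close> times, or from multiplying each part by
  \<open>a\<close>. The first reading leads to type (ii), the second to type (iii), so one set
  serves both bijections.\<close>

definition two_partitions :: "nat \<Rightarrow> nat \<Rightarrow> nat \<Rightarrow> (nat multiset \<times> nat multiset) set" where
  "two_partitions a b n =
    {(X, Y). (\<forall>p \<in># X + Y. 0 < p) \<and> a * \<Sum>\<^sub># X + b * \<Sum>\<^sub># Y = n}"

lemma sum_mset_repeat_mset: "\<Sum>\<^sub># (repeat_mset k M) = k * \<Sum>\<^sub># M" for M :: "nat multiset"
  by (induction k) auto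

lemma set_mset_repeat_mset: "0 < k \<Longrightarrow> set_mset (repeat_mset k M) = set_mset M"
  by (auto simp flip: count_greater_zero_iff)

text \<open>When \<open>f 0 = 0\<close> the support stays finite, and \<open>Abs_multiset\<close>
  then receives a genuine multiplicity function.\<close>

definition map_count :: "(nat \<Rightarrow> nat) \<Rightarrow> 'a multiset \<Rightarrow> 'a multiset" where
  "map_count f M = Abs_multiset (\<lambda>x. f (count M x))"

lemma count_map_count:
  assumes "f 0 = 0"
  shows "count (map_count f M) x = f (count M x)"
proof -
  have "{x. 0 < f (count M x)} \<subseteq> set_mset M"
    using assms by (auto intro!: count_inI)
  then have "finite {x. 0 < f (count M x)}"
    by (rule finite_subset) simp
  then show ?thesis by (simp add: map_count_def count_Abs_multiset)
qed

lemma set_map_count: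
  assumes "f 0 = 0"
  shows "set_mset (map_count f M) \<subseteq> set_mset M"
  using assms by (auto intro!: count_inI simp: count_map_count simp flip: count_greater_zero_iff)

text \<open>Each multiplicity \<open>y\<close> in \<open>Y\<close> is divided by \<open>c\<close>:
  the quotient goes to \<open>Q\<close> with weight \<open>b * c = L\<close>, and the remainder
  \<open>r\<close> joins the multiplicity \<open>x\<close> in \<open>X\<close> to form
  \<open>a * x + b * r\<close>. Uniqueness of this form with \<open>r < c\<close> makes the map
  invertible. The assumptions on \<open>c\<close> amount to
  \<open>c = a div gcd a b\<close>.\<close>

lemma bij_betw_count_semigroup:
  fixes a b c n :: nat
  assumes "0 < a" "0 < b" "0 < c" and L: "b * c = L" and dvd: "a dvd b * c"
    and cop: "\<And>y. a dvd b * y \<longleftrightarrow> c dvd y"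
  shows "bij_betw
    (\<lambda>(X, Y). (map_count (\<lambda>y. y div c) Y, repeat_mset a X + repeat_mset b (map_count (\<lambda>y. y mod c) Y)))
    (two_partitions a b n)
    (SIGMA Q:scaled_partitions L n. {P. \<forall>p \<in># P. count P p \<in> semigroup_gen2 a b}
       \<inter> partitions_of (n - L * \<Sum>\<^sub># Q))"
    (is "bij_betw ?f _ ?B")
proof -
  let ?S = "semigroup_gen2 a b"
  have zero: "0 \<in> ?S" by (auto simp: semigroup_gen2_def)
  have "\<exists>x y. y < c \<and> x * a + y * b = s" if "s \<in> ?S" for s
  proof -
    obtain x y where s: "s = x * a + y * b" using \<open>s \<in> ?S\<close> by (auto simp: semigroup_gen2_def)
    obtain k where k: "b * c = a * k" using dvd by blast
    \<comment> \<open>Each block of \<open>c\<close> copies of \<open>b\<close> is traded for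
      \<open>k\<close> copies of \<open>a\<close>, leaving a coefficient of \<open>b\<close> below
      \<open>c\<close>.\<close>
    have "y * b = (y div c) * (b * c) + (y mod c) * b"
      by (metis add.commute distrib_right mod_div_mult_eq mult.assoc mult.commute)
    then have "s = (x + (y div c) * k) * a + (y mod c) * b"
      by (simp add: s k algebra_simps)
    then show ?thesis using \<open>0 < c\<close> by (metis mod_less_divisor)
  qed
  then obtain u v where uv: "\<And>s. s \<in> ?S \<Longrightarrow> v s < c" "\<And>s. s \<in> ?S \<Longrightarrow> u s * a + v s * b = s"
    by metis
  \<comment> \<open>Vanishing at 0 makes \<open>u\<close> and \<open>v\<close> admissible in
    \<open>map_count\<close>.\<close>
  have uv0: "u 0 = 0" "v 0 = 0" using uv(2)[OF zero] assms by auto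
  \<comment> \<open>Otherwise \<open>c\<close> would divide \<open>y - y'\<close>, which is positive
    and below \<open>c\<close>. Used in both directions, this gives uniqueness of the coefficient of
    \<open>b\<close>.\<close>
  have le: "y \<le> y'" if "a * x + b * y = a * x' + b * y'" "y < c" for x y x' y'
  proof -
    have "b * (y - y') = a * (x' - x)"
      using that(1) by (simp add: diff_mult_distrib2)
    then have "c dvd y - y'" by (simp flip: cop)
    then show ?thesis using \<open>y < c\<close> by (metis diff_is_0_eq less_imp_diff_less nat_dvd_not_less neq0_conv)
  qed
  have v_eq: "v (a * x + b * y) = y" if "y < c" for x y
  proof -
    let ?s = "a * x + b * y"
    have s: "?s \<in> ?S" by (force simp: semigroup_gen2_def mult.commute)
    have "a * u ?s + b * v ?s = a * x + b * y" using uv(2)[OF s] by (simp add: mult.commute)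
    then show ?thesis using le uv(1)[OF s] that by (metis order_antisym)
  qed
  have u_eq: "u (a * x + b * y) = x" if "y < c" for x y
  proof -
    have "a * x + b * y \<in> ?S" by (force simp: semigroup_gen2_def mult.commute)
    from uv(2)[OF this] show ?thesis using assms(1) by (simp add: v_eq[OF that] mult.commute)
  qed
  let ?g = "\<lambda>(Q, P). (map_count u P, map_count v P + repeat_mset c Q)"
  \<comment> \<open>Values that are not parts have count 0, which lies in \<open>S\<close> as
    well.\<close>
  have countS: "count P x \<in> ?S" if "\<forall>p \<in># P. count P p \<in> ?S" for P :: "nat multiset" and x
    using that zero by (cases "x \<in># P") (auto simp: not_in_iff)
  have decomp: "repeat_mset c (map_count (\<lambda>y. y div c) Y) + map_count (\<lambda>y. y mod c) Y = Y"
    for Y :: "nat multiset"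
    by (rule multiset_eqI) (simp add: count_map_count)
  have uvsum: "repeat_mset a (map_count u P) + repeat_mset b (map_count v P) = P"
    if "\<forall>p \<in># P. count P p \<in> ?S" for P :: "nat multiset"
    by (rule multiset_eqI) (use uv(2) countS[OF that] in \<open>simp add: count_map_count uv0 mult.commute\<close>)
  show ?thesis
  proof (rule bij_betw_byWitness[where f' = ?g])
    show "\<forall>z \<in> two_partitions a b n. ?g (?f z) = z"
      using \<open>0 < c\<close> by (auto intro!: multiset_eqI simp: count_map_count uv0 u_eq v_eq)
    show "\<forall>z \<in> ?B. ?f (?g z) = z"
    proof clarsimp
      fix Q P :: "nat multiset" assume P: "\<forall>p \<in># P. count P p \<in> ?S"
      \<comment> \<open>Since \<open>v\<close> stays below \<open>c\<close>, division of
        \<open>v s + c * q\<close> by \<open>c\<close> returns quotient \<open>q\<close> and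
        remainder \<open>v s\<close>.\<close>
      have lt: "v (count P x) < c" for x using countS[OF P] uv(1) by blast
      have "map_count (\<lambda>y. y mod c) (map_count v P + repeat_mset c Q) = map_count v P"
        by (rule multiset_eqI) (simp add: count_map_count uv0 lt)
      moreover have "map_count (\<lambda>y. y div c) (map_count v P + repeat_mset c Q) = Q"
        by (rule multiset_eqI) (use \<open>0 < c\<close> in \<open>simp add: count_map_count uv0 lt\<close>)
      ultimately show "map_count (\<lambda>y. y div c) (map_count v P + repeat_mset c Q) = Q \<and>
          repeat_mset a (map_count u P) +
          repeat_mset b (map_count (\<lambda>y. y mod c) (map_count v P + repeat_mset c Q)) = P"
        using uvsum[OF P] by simp
    qed
    show "?f ` two_partitions a b n \<subseteq> ?B"
    proof
      fix z assume "z \<in> ?f ` two_partitions a b n"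
      then obtain w where w: "z = ?f w" "w \<in> two_partitions a b n" by (rule imageE)
      obtain X Y where "w = (X, Y)" by (cases w)
      with w have XY: "(X, Y) \<in> two_partitions a b n" and z: "z = ?f (X, Y)" by simp_all
      let ?Q = "map_count (\<lambda>y. y div c) Y" and ?R = "map_count (\<lambda>y. y mod c) Y"
      have "set_mset ?Q \<subseteq> set_mset Y" "set_mset ?R \<subseteq> set_mset Y"
        by (simp_all add: set_map_count)
      then have pos: "\<forall>p \<in># ?Q. 0 < p" "\<forall>p \<in># ?R. 0 < p" "\<forall>p \<in># X. 0 < p"
        using XY by (auto simp: two_partitions_def)
      have "\<Sum>\<^sub># Y = c * \<Sum>\<^sub># ?Q + \<Sum>\<^sub># ?R"
        by (subst decomp[of Y, symmetric]) (simp only: sum_mset.union sum_mset_repeat_mset)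
      then have n: "n = L * \<Sum>\<^sub># ?Q + (a * \<Sum>\<^sub># X + b * \<Sum>\<^sub># ?R)"
        using XY by (simp add: two_partitions_def L[symmetric] algebra_simps)
      have "count (repeat_mset a X + repeat_mset b ?R) p \<in> ?S" for p
        by (force simp: semigroup_gen2_def mult.commute)
      then have "repeat_mset a X + repeat_mset b ?R \<in>
          {P. \<forall>p \<in># P. count P p \<in> ?S} \<inter> partitions_of (n - L * \<Sum>\<^sub># ?Q)"
        using pos n assms(1,2)
        by (auto simp: partitions_of_def sum_mset_repeat_mset set_mset_repeat_mset)
      moreover have "?Q \<in> scaled_partitions L n"
        using pos n by (simp add: scaled_partitions_def)
      ultimately show "z \<in> ?B" unfolding z prod.case by (intro SigmaI)
    qed
    show "?g ` ?B \<subseteq> two_partitions a b n"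
    proof clarsimp
      fix Q P assume Q: "Q \<in> scaled_partitions L n" and P: "\<forall>p \<in># P. count P p \<in> ?S"
        "P \<in> partitions_of (n - L * \<Sum>\<^sub># Q)"
      have sub: "set_mset (map_count u P) \<subseteq> set_mset P" "set_mset (map_count v P) \<subseteq> set_mset P"
        by (simp_all add: set_map_count uv0)
      have "a * \<Sum>\<^sub># (map_count u P) + b * \<Sum>\<^sub># (map_count v P) = \<Sum>\<^sub># P"
        using arg_cong[OF uvsum[OF P(1)], of sum_mset]
        by (simp only: sum_mset.union sum_mset_repeat_mset)
      then have "a * \<Sum>\<^sub># (map_count u P) + b * \<Sum>\<^sub># (map_count v P + repeat_mset c Q) = n"
        using P(2) Q by (auto simp: partitions_of_def scaled_partitions_def sum_mset_repeat_mset L[symmetric] algebra_simps)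
      then show "(map_count u P, map_count v P + repeat_mset c Q) \<in> two_partitions a b n"
        using P(2) Q sub \<open>0 < c\<close>
        by (auto simp: two_partitions_def partitions_of_def scaled_partitions_def set_mset_repeat_mset)
    qed
  qed
qed

section \<open>Parts divisible by \<open>a\<close> or \<open>b\<close>\<close>

lemma sum_mset_image_times: "\<Sum>\<^sub># (image_mset ((*) k) M) = k * \<Sum>\<^sub># M" for k :: nat
  by (induction M) (auto simp: algebra_simps)

lemma image_times_div:
  fixes k :: nat
  assumes "\<forall>p \<in># M. k dvd p"
  shows "image_mset ((*) k) (image_mset (\<lambda>p. p div k) M) = M"
  using assms by (induction M) auto

lemma image_div_times:
  fixes k :: nat
  assumes "0 < k"
  shows "image_mset (\<lambda>p. p div k) (image_mset ((*) k) M) = M"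
  using assms by (induction M) auto

text \<open>The parts \<open>c * q\<close> of \<open>Y\<close> go to \<open>Q\<close>, since
  \<open>b * (c * q) = L * q\<close>. The other parts become \<open>b * y\<close> with
  \<open>c\<close> not dividing \<open>y\<close>, which are exactly the multiples of
  \<open>b\<close> not divisible by \<open>a\<close>. Divisibility by \<open>a\<close> therefore
  separates the two sources of \<open>P\<close> again.\<close>

lemma bij_betw_dvd_parts:
  fixes a b c n :: nat
  assumes "0 < a" "0 < b" "0 < c" and L: "b * c = L" and dvd: "a dvd b * c"
    and cop: "\<And>y. a dvd b * y \<longleftrightarrow> c dvd y"
  shows "bij_betw
    (\<lambda>(X, Y). (image_mset (\<lambda>y. y div c) (filter_mset (\<lambda>y. c dvd y) Y),
      image_mset ((*) a) X + image_mset ((*) b) (filter_mset (\<lambda>y. \<not> c dvd y) Y)))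
    (two_partitions a b n)
    (SIGMA Q:scaled_partitions L n. {P. \<forall>p \<in># P. a dvd p \<or> b dvd p}
       \<inter> partitions_of (n - L * \<Sum>\<^sub># Q))"
    (is "bij_betw ?f _ ?B")
proof -
  let ?g = "\<lambda>(Q, P). (image_mset (\<lambda>p. p div a) (filter_mset (\<lambda>p. a dvd p) P),
    image_mset ((*) c) Q + image_mset (\<lambda>p. p div b) (filter_mset (\<lambda>p. \<not> a dvd p) P))"
  have fa: "filter_mset (\<lambda>p. a dvd p) (image_mset ((*) a) X) = image_mset ((*) a) X"
    "filter_mset (\<lambda>p. \<not> a dvd p) (image_mset ((*) a) X) = {#}" for X
    by (simp_all add: filter_mset_eq_conv filter_mset_eq_mempty_iff)
  have fb: "filter_mset (\<lambda>p. a dvd p) (image_mset ((*) b) (filter_mset (\<lambda>y. \<not> c dvd y) Y)) = {#}"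
    "filter_mset (\<lambda>p. \<not> a dvd p) (image_mset ((*) b) (filter_mset (\<lambda>y. \<not> c dvd y) Y))
      = image_mset ((*) b) (filter_mset (\<lambda>y. \<not> c dvd y) Y)" for Y
    by (simp_all add: filter_mset_eq_conv filter_mset_eq_mempty_iff cop)
  have fc: "filter_mset (\<lambda>p. c dvd p) (image_mset ((*) c) X) = image_mset ((*) c) X"
    "filter_mset (\<lambda>p. \<not> c dvd p) (image_mset ((*) c) X) = {#}" for X
    by (simp_all add: filter_mset_eq_conv filter_mset_eq_mempty_iff)
  \<comment> \<open>A part not divisible by \<open>a\<close> has the form \<open>b * y\<close>, and
    then \<open>cop\<close> excludes that \<open>c\<close> divides \<open>y\<close>.\<close>
  have fd: "filter_mset (\<lambda>p. c dvd p) (image_mset (\<lambda>p. p div b) (filter_mset (\<lambda>p. \<not> a dvd p) P)) = {#}"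
    "filter_mset (\<lambda>p. \<not> c dvd p) (image_mset (\<lambda>p. p div b) (filter_mset (\<lambda>p. \<not> a dvd p) P))
      = image_mset (\<lambda>p. p div b) (filter_mset (\<lambda>p. \<not> a dvd p) P)"
    if "\<forall>p \<in># P. a dvd p \<or> b dvd p" for P
    using that by (auto simp add: filter_mset_eq_conv filter_mset_eq_mempty_iff cop[symmetric])
  have pd: "0 < p div k" if "k dvd p" "0 < p" for k p :: nat
    using that by (auto elim!: dvdE)
  have times_div_c: "image_mset ((*) c) (image_mset (\<lambda>y. y div c) (filter_mset (\<lambda>y. c dvd y) Y))
      = filter_mset (\<lambda>y. c dvd y) Y" for Y
    by (rule image_times_div) simp
  have times_div_a: "image_mset ((*) a) (image_mset (\<lambda>y. y div a) (filter_mset (\<lambda>y. a dvd y) Y))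
      = filter_mset (\<lambda>y. a dvd y) Y" for Y
    by (rule image_times_div) simp
  have times_div_b: "image_mset ((*) b) (image_mset (\<lambda>y. y div b) (filter_mset (\<lambda>y. \<not> a dvd y) P))
      = filter_mset (\<lambda>y. \<not> a dvd y) P" if "\<forall>p \<in># P. a dvd p \<or> b dvd p" for P
    by (rule image_times_div) (use that in auto)
  show ?thesis
  proof (rule bij_betw_byWitness[where f' = ?g])
    show "\<forall>z \<in> two_partitions a b n. ?g (?f z) = z"
      by (auto simp: fa fb times_div_c image_div_times assms(1,2)
          simp del: multiset.map_comp image_mset.compositionality simp flip: multiset_partition)
    show "\<forall>z \<in> ?B. ?f (?g z) = z"
      by (auto simp: fc fd times_div_a times_div_b image_div_times assms(3)
          simp del: multiset.map_comp image_mset.compositionality simp flip: multiset_partition)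
    show "?f ` two_partitions a b n \<subseteq> ?B"
    proof
      fix z assume "z \<in> ?f ` two_partitions a b n"
      then obtain w where w: "z = ?f w" "w \<in> two_partitions a b n" by (rule imageE)
      obtain X Y where "w = (X, Y)" by (cases w)
      with w have XY: "(X, Y) \<in> two_partitions a b n" and z: "z = ?f (X, Y)" by simp_all
      let ?Q = "image_mset (\<lambda>y. y div c) (filter_mset (\<lambda>y. c dvd y) Y)"
      let ?R = "filter_mset (\<lambda>y. \<not> c dvd y) Y"
      have "\<Sum>\<^sub># Y = c * \<Sum>\<^sub># ?Q + \<Sum>\<^sub># ?R"
        unfolding sum_mset_image_times[symmetric] times_div_c
        by (metis multiset_partition sum_mset.union)
      then have n: "n = L * \<Sum>\<^sub># ?Q + (a * \<Sum>\<^sub># X + b * \<Sum>\<^sub># ?R)"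
        using XY by (simp add: two_partitions_def L[symmetric] algebra_simps)
      have "\<forall>q \<in># X + ?R. 0 < q"
        using XY by (auto simp: two_partitions_def)
      moreover have "\<forall>q \<in># ?Q. 0 < q"
        using XY by (auto simp: two_partitions_def dvd_div_eq_0_iff)
      ultimately have "?Q \<in> scaled_partitions L n"
        "image_mset ((*) a) X + image_mset ((*) b) ?R \<in>
          {P. \<forall>p\<in>#P. a dvd p \<or> b dvd p} \<inter> partitions_of (n - L * \<Sum>\<^sub># ?Q)"
        using n assms(1,2) by (auto simp: scaled_partitions_def partitions_of_def sum_mset_image_times)
      then show "z \<in> ?B" unfolding z prod.case by (rule SigmaI)
    qed
    show "?g ` ?B \<subseteq> two_partitions a b n"
    proof (rule image_subsetI, clarify)
      fix Q P assume Q: "Q \<in> scaled_partitions L n" and P: "\<forall>p \<in># P. a dvd p \<or> b dvd p"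
        "P \<in> partitions_of (n - L * \<Sum>\<^sub># Q)"
      let ?X = "image_mset (\<lambda>p. p div a) (filter_mset (\<lambda>p. a dvd p) P)"
      let ?R = "image_mset (\<lambda>p. p div b) (filter_mset (\<lambda>p. \<not> a dvd p) P)"
      have "a * \<Sum>\<^sub># ?X + b * \<Sum>\<^sub># ?R = \<Sum>\<^sub># P"
        unfolding sum_mset_image_times[symmetric] times_div_a times_div_b[OF P(1)]
        by (metis multiset_partition sum_mset.union)
      then have "a * \<Sum>\<^sub># ?X + b * \<Sum>\<^sub># (image_mset ((*) c) Q + ?R) = n"
        using P(2) Q by (auto simp: partitions_of_def scaled_partitions_def sum_mset_image_times L[symmetric] algebra_simps)
      moreover have "\<forall>p \<in># ?X + (image_mset ((*) c) Q + ?R). 0 < p"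
        using P Q assms(3) by (auto simp: scaled_partitions_def partitions_of_def intro!: pd)
      ultimately show "(?X, image_mset ((*) c) Q + ?R) \<in> two_partitions a b n"
        by (simp add: two_partitions_def)
    qed
  qed
qed

section \<open>Combining the bijections\<close>

text \<open>Both families, paired with \<open>scaled_partitions\<close>, are in bijection with the
  same \<open>two_partitions\<close>; cancellation then compares the families themselves.\<close>

lemma card_counts_eq_card_dvd:
  assumes "0 < a" and "0 < b"
  shows "card {P \<in> partitions_of n. \<forall>p \<in># P. count P p \<in> semigroup_gen2 a b}
    = card {P \<in> partitions_of n. \<forall>p \<in># P. a dvd p \<or> b dvd p}"
proof -
  \<comment> \<open>With this choice \<open>b * c\<close> is the least common multiple of
    \<open>a\<close> and \<open>b\<close>.\<close>
  define c where "c = a div gcd a b"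
  have a: "a = gcd a b * c" by (simp add: c_def)
  have c: "0 < c" using assms a by (metis gr0I mult_0_right)
  have cop: "a dvd b * y \<longleftrightarrow> c dvd y" for y
  proof -
    have b: "b = gcd a b * (b div gcd a b)" by simp
    have "coprime c (b div gcd a b)"
      unfolding c_def using assms by (intro div_gcd_coprime) simp
    \<comment> \<open>The common factor \<open>gcd a b\<close> is cancelled from both sides of the
      divisibility.\<close>
    moreover have "a dvd b * y \<longleftrightarrow> c dvd (b div gcd a b) * y"
      using assms by (metis a b gcd_eq_0_iff less_numeral_extra(3) mult.assoc nat_mult_dvd_cancel_disj)
    ultimately show ?thesis by (simp add: coprime_dvd_mult_right_iff)
  qed
  have dvd: "a dvd b * c" by (simp add: cop)
  have "card ({P. \<forall>p \<in># P. count P p \<in> semigroup_gen2 a b} \<inter> partitions_of n)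
    = card ({P. \<forall>p \<in># P. a dvd p \<or> b dvd p} \<inter> partitions_of n)"
  proof (rule card_partitions_cancel[of "b * c"])
    show "0 < b * c" using assms c by simp
    show "card (SIGMA Q:scaled_partitions (b * c) m. {P. \<forall>p \<in># P. count P p \<in> semigroup_gen2 a b}
          \<inter> partitions_of (m - b * c * \<Sum>\<^sub># Q))
      = card (SIGMA Q:scaled_partitions (b * c) m. {P. \<forall>p \<in># P. a dvd p \<or> b dvd p}
          \<inter> partitions_of (m - b * c * \<Sum>\<^sub># Q))" for m
      using bij_betw_same_card[OF bij_betw_count_semigroup[OF assms c refl dvd cop]]
        bij_betw_same_card[OF bij_betw_dvd_parts[OF assms c refl dvd cop]] by metis
  qed
  then show ?thesis by (simp add: Collect_conj_eq Int_commute)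
qed

theorem theorem1:
  fixes n a1 a2 :: nat
  assumes "0 < n" and "0 < a1" and "0 < a2"
  shows "card {P \<in> partitions_of n.
            (\<forall>p \<in># P. p \<in> semigroup_gen2 a1 a2) \<and>
            (\<forall>p \<in># P. \<forall>q \<in># P. q \<le> p \<longrightarrow> p - q \<in> semigroup_gen2 a1 a2)}
         = card {P \<in> partitions_of n. \<forall>p \<in># P. count P p \<in> semigroup_gen2 a1 a2}
       \<and> card {P \<in> partitions_of n. \<forall>p \<in># P. count P p \<in> semigroup_gen2 a1 a2}
         = card {P \<in> partitions_of n. \<forall>p \<in># P. a1 dvd p \<or> a2 dvd p}"
proof
  show "card {P \<in> partitions_of n. (\<forall>p \<in># P. p \<in> semigroup_gen2 a1 a2) \<and>
      (\<forall>p \<in># P. \<forall>q \<in># P. q \<le> p \<longrightarrow> p - q \<in> semigroup_gen2 a1 a2)}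
    = card {P \<in> partitions_of n. \<forall>p \<in># P. count P p \<in> semigroup_gen2 a1 a2}"
  proof (rule card_diffs_eq_card_counts)
    show "0 \<in> semigroup_gen2 a1 a2" by (auto simp: semigroup_gen2_def)
    fix s t assume "s \<in> semigroup_gen2 a1 a2" "t \<in> semigroup_gen2 a1 a2"
    then obtain x y x' y' where "s = x * a1 + y * a2" "t = x' * a1 + y' * a2"
      by (auto simp: semigroup_gen2_def)
    then have "s + t = (x + x') * a1 + (y + y') * a2" by (simp add: algebra_simps)
    then show "s + t \<in> semigroup_gen2 a1 a2" by (auto simp: semigroup_gen2_def)
  qed
qed (rule card_counts_eq_card_dvd[OF assms(2,3)])

end
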